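(* Consider a sequence of one-period robust binomial models with parameters $u^n,U^n,d^n,D^n,\pi^n,\Pi^n$ satisfying (A1)–(A4) as listed in the context, with limits $d,D,u,U$. Let $U<+\infty$. Then the following properties are equivalent: (i) NAA1$(\mathcal{P}^n)$; (ii) $d<1<U$; (iii) for each sequence $(P^n)_{n\ge1}$ with $P^n\in\mathcal{P}^n$ for all $n$, there exists a sequence $(Q^n)_{n\ge1}$ with $Q^n\in\mathcal{Q}^n$ for all $n$ such that $(P^n)_{n\ge1}\triangleleft(Q^n)_{n\ge1}$.
   Context: Assumptions on the real parameters $u^n,U^n,d^n,D^n,\pi^n,\Pi^n$, for all $n\in\mathbb{N}$: (A1) $0<\pi^n\le\Pi^n<1$; $d^n\le D^n$ and $u^n\le U^n$; $0<d^n<1<U^n$. (A2) $d^n<\min(u^n,D^n)$ and $\max(u^n,D^n)<U^n$. (A3) There exist $d\in[0,1]$, $D\in[0,+\infty]$, $u\in[0,+\infty]$, $U\in[1,+\infty]$ with $d^n\to d$, $D^n\to D$, $u^n\to u$, $U^n\to U$. (A4) $d<U$; $[d,D]\ne\{1\}$ or $\limsup\Pi^n>0$; $[u,U]\ne\{1\}$ or $\liminf\pi^n<1$. Model: $\Omega^n=\Omega=(0,+\infty)$ with Borel $\sigma$-algebra $\mathcal{F}$; $S^n_0=1$, $S^n_1=Y^n_1$, where $Y^n_1:(0,+\infty)\to(0,+\infty)$ is a bijective measurable map. Let $I^n=[u^n,U^n]\times[d^n,D^n]\times[\pi^n,\Pi^n]$ and $\mathcal{L}^n_1=\{p\,\delta_{x}+(1-p)\,\delta_{y}:(x,y,p)\in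 I^n\}$. $\mathcal{R}^n$ is the set of probability measures $R$ on $(\Omega,\mathcal{F})$ whose law $R\circ(Y^n_1)^{-1}$ belongs to $\mathcal{L}^n_1$. $\mathcal{P}^n=\{\sum_{k=1}^\infty\alpha_kR_k:R_k\in\mathcal{R}^n,\ 0\le\alpha_k\le1,\ \sum_k\alpha_k=1\}$. Extended $\sigma$-algebra: for $R\in\mathcal{R}^n$ write $R\circ(Y^n_1)^{-1}=\pi_R\delta_{u_R}+(1-\pi_R)\delta_{d_R}$ with $(u_R,d_R,\pi_R)\in I^n$, and $S_R=\{Y^n_1=d_R\}\cup\{Y^n_1=u_R\}$. Fix $\widetilde{\mathcal{R}}^n\subseteq\mathcal{R}^n$ such that the sets $S_R$, $R\in\widetilde{\mathcal{R}}^n$, are pairwise disjoint and such that $\widetilde{\mathcal{R}}^n$ and $\mathcal{R}^n$ have the same null sets in $\mathcal{F}$ (a set $A\in\mathcal F$ is null for all measures of one family iff it is for the other). Put $\widetilde{\mathcal{F}}^n=\sigma\bigl(\mathcal{F}\cup\{\bigcup_{R\in\widetilde{\mathcal{R}}^n}E_R:E_R\subseteq S_R,\ E_R\in\mathcal{F}\}\bigr)$. Each $P\in\mathcal{P}^n$ is extended to $\widetilde{\mathcal{F}}^n$ by $P(A)=\sum_kP(A\cap S_{R_k})$, where $(R_k)$ are the (at most countably many) elements of $\widetilde{\mathcal{R}}^n$ with $P(S_{R_k})\ne0$. From now on the $n$-th market is $(\Omega,\widetilde{\mathcal{F}}^n)$ with $\mathcal{P}^n$ denoting the set of extended measures. $\mathcal{P}^n$-q.s.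 means outside a set contained in a set of $\widetilde{\mathcal{F}}^n$ that is $P$-null for all $P\in\mathcal{P}^n$. $\mathcal{Q}^n$ is the set of probability measures $Q$ on $(\Omega,\widetilde{\mathcal{F}}^n)$ with $Q\ll P$ for some $P\in\mathcal{P}^n$ and $E_Q[S^n_1-S^n_0]=0$ (with convention $E_Q[f]=E_Q[f^+]-E_Q[f^-]$, $\infty-\infty=-\infty$). AA1$(\mathcal{P}^n)$: there exist a subsequence $n_k$, $H^{n_k}\in\mathbb{R}$, and positive reals $c_k\to0$ such that $X^k_1=H^{n_k}(S^{n_k}_1-S^{n_k}_0)$ satisfies (i) $X^k_1\ge-c_k$ $\mathcal{P}^{n_k}$-q.s. for all $k$, and (ii) there exist $\alpha>0$ and $P^k\in\mathcal{P}^{n_k}$ with $P^k(X^k_1\ge\alpha)\ge\alpha$ for all $k$. NAA1$(\mathcal{P}^n)$ means no AA1$(\mathcal{P}^n)$ exists. Contiguity: $(P^n)\triangleleft(Q^n)$ means that $Q^n(A^n)\to0$ with $A^n\in\widetilde{\mathcal{F}}^n$ implies $P^n(A^n)\to0$. *)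

theory Defs
  imports "HOL-Probability.Giry_Monad"
begin

section \<open>One-period robust binomial markets\<close>

text \<open>The state space \<open>\<Omega> = (0,\<infinity>)\<close> with its Borel \<open>\<sigma>\<close>-algebra; the measure carried by
  \<open>pos_borel\<close> itself plays no role.\<close>

definition pos_borel :: "real measure" where
  "pos_borel = restrict_space borel {0<..}"

text \<open>The field \<open>price\<close> is the map \<open>Y\<^sub>1\<close>, and \<open>Rtilde\<close> is the chosen subfamily of the set of
  priors that is used to enlarge the \<open>\<sigma>\<close>-algebra.\<close>

record market =
  u_low :: real
  u_high :: real
  d_low :: real
  d_high :: real
  p_low :: real
  p_high :: real
  price :: "real \<Rightarrow> real"
  Rtilde :: "real measure set"

definition S0 :: "market \<Rightarrow> real \<Rightarrow> real" where
  "S0 m \<omega> = 1"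

definition S1 :: "market \<Rightarrow> real \<Rightarrow> real" where
  "S1 m \<omega> = price m \<omega>"

definition param_box :: "market \<Rightarrow> (real \<times> real \<times> real) set" where
  "param_box m = {u_low m..u_high m} \<times> {d_low m..d_high m} \<times> {p_low m..p_high m}"

definition two_point :: "real \<Rightarrow> real \<Rightarrow> real \<Rightarrow> real measure" where
  "two_point x y p = measure_of (space pos_borel) (sets pos_borel)
     (\<lambda>A. ennreal p * emeasure (return pos_borel x) A
        + ennreal (1 - p) * emeasure (return pos_borel y) A)"

definition laws :: "market \<Rightarrow> real measure set" where
  "laws m = {two_point x y p | x y p. (x, y, p) \<in> param_box m}"

definition law :: "market \<Rightarrow> real measure \<Rightarrow> real measure" where
  "law m R = distr R pos_borel (price m)"

definition two_point_priors :: "market \<Rightarrow> real measure set" where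
  "two_point_priors m =
     {R. prob_space R \<and> sets R = sets pos_borel \<and> law m R \<in> laws m}"

definition countable_mixture ::
  "(nat \<Rightarrow> real) \<Rightarrow> (nat \<Rightarrow> real measure) \<Rightarrow> real measure" where
  "countable_mixture \<alpha> R = measure_of (space pos_borel) (sets pos_borel)
     (\<lambda>A. \<Sum>k. ennreal (\<alpha> k) * emeasure (R k) A)"

definition borel_priors :: "market \<Rightarrow> real measure set" where
  "borel_priors m = {countable_mixture \<alpha> R | \<alpha> R.
     (\<forall>k. R k \<in> two_point_priors m) \<and> (\<forall>k. 0 \<le> \<alpha> k \<and> \<alpha> k \<le> 1) \<and> \<alpha> sums 1}"

section \<open>The enlarged \<open>\<sigma>\<close>-algebra\<close>

text \<open>A triple \<open>(u\<^sub>R, d\<^sub>R, \<pi>\<^sub>R)\<close> representing the law of \<open>R\<close>. It need not be unique when the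
  intervals for \<open>u\<^sub>R\<close> and \<open>d\<^sub>R\<close> overlap, but as \<open>0 < \<pi>\<^sub>R < 1\<close> the set \<open>{u\<^sub>R, d\<^sub>R}\<close>, and with it
  \<open>carrier_set\<close> below (written \<open>S\<^sub>R\<close> in comments), does not depend on the choice.\<close>

definition params_of :: "market \<Rightarrow> real measure \<Rightarrow> real \<times> real \<times> real" where
  "params_of m R = (SOME t. t \<in> param_box m \<and>
     (case t of (x, y, p) \<Rightarrow> law m R = two_point x y p))"

definition carrier_set :: "market \<Rightarrow> real measure \<Rightarrow> real set" where
  "carrier_set m R = (case params_of m R of (x, y, p) \<Rightarrow>
     {\<omega> \<in> space pos_borel. price m \<omega> = y} \<union> {\<omega> \<in> space pos_borel. price m \<omega> = x})"

definition valid_market :: "market \<Rightarrow> bool" where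
  "valid_market m \<longleftrightarrow>
     price m \<in> measurable pos_borel pos_borel \<and>
     bij_betw (price m) {0<..} {0<..} \<and>
     Rtilde m \<subseteq> two_point_priors m \<and>
     disjoint_family_on (carrier_set m) (Rtilde m) \<and>
     (\<forall>A\<in>sets pos_borel. (\<forall>R\<in>Rtilde m. emeasure R A = 0) \<longleftrightarrow>
                         (\<forall>R\<in>two_point_priors m. emeasure R A = 0))"

definition ext_generator :: "market \<Rightarrow> real set set" where
  "ext_generator m = sets pos_borel \<union>
     {\<Union>R\<in>Rtilde m. E R | E. \<forall>R\<in>Rtilde m. E R \<subseteq> carrier_set m R \<and> E R \<in> sets pos_borel}"

definition ext_space :: "market \<Rightarrow> real measure" where
  "ext_space m = sigma (space pos_borel) (ext_generator m)"

text \<open>The sum below ranges over the at most countably many \<open>R\<close> in \<open>Rtilde m\<close> whose \<open>S\<^sub>R\<close> is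
  charged by \<open>P\<close>. Since each \<open>S\<^sub>R\<close> has at most two points, \<open>A \<inter> S\<^sub>R\<close> is a Borel set
  for every \<open>A \<subseteq> \<Omega>\<close>.\<close>

definition ext_measure :: "market \<Rightarrow> real measure \<Rightarrow> real measure" where
  "ext_measure m P = measure_of (space pos_borel) (ext_generator m)
     (\<lambda>A. \<Sum>\<^sub>\<infinity>R\<in>{R \<in> Rtilde m. emeasure P (carrier_set m R) \<noteq> 0}.
            emeasure P (A \<inter> carrier_set m R))"

definition priors :: "market \<Rightarrow> real measure set" where
  "priors m = ext_measure m ` borel_priors m"

section \<open>Martingale measures, asymptotic arbitrage and contiguity\<close>

text \<open>The expectation \<open>E[f\<^sup>+] - E[f\<^sup>-]\<close> with the convention \<open>\<infinity> - \<infinity> = -\<infinity>\<close>, which is not the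
  one built into \<^typ>\<open>ereal\<close>.\<close>

definition ext_expectation :: "'a measure \<Rightarrow> ('a \<Rightarrow> real) \<Rightarrow> ereal" where
  "ext_expectation Q f =
     (let pos_part = (\<integral>\<^sup>+\<omega>. ennreal (max 0 (f \<omega>)) \<partial>Q);
          neg_part = (\<integral>\<^sup>+\<omega>. ennreal (max 0 (- f \<omega>)) \<partial>Q)
      in if neg_part = \<infinity> then - \<infinity> else enn2ereal pos_part - enn2ereal neg_part)"

definition martingale_measures :: "market \<Rightarrow> real measure set" where
  "martingale_measures m =
     {Q. prob_space Q \<and> sets Q = sets (ext_space m) \<and>
         (\<exists>P\<in>priors m. absolutely_continuous P Q) \<and>
         ext_expectation Q (\<lambda>\<omega>. S1 m \<omega> - S0 m \<omega>) = 0}"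

definition quasi_surely :: "market \<Rightarrow> (real \<Rightarrow> bool) \<Rightarrow> bool" where
  "quasi_surely m \<phi> \<longleftrightarrow>
     (\<exists>N\<in>sets (ext_space m). (\<forall>P\<in>priors m. emeasure P N = 0) \<and>
        {\<omega> \<in> space (ext_space m). \<not> \<phi> \<omega>} \<subseteq> N)"

definition AA1 :: "(nat \<Rightarrow> market) \<Rightarrow> bool" where
  "AA1 M \<longleftrightarrow>
     (\<exists>(r :: nat \<Rightarrow> nat) (H :: nat \<Rightarrow> real) (c :: nat \<Rightarrow> real).
        strict_mono r \<and> (\<forall>k. 0 < c k) \<and> c \<longlonglongrightarrow> 0 \<and>
        (\<forall>k. quasi_surely (M (r k))
           (\<lambda>\<omega>. H k * (S1 (M (r k)) \<omega> - S0 (M (r k)) \<omega>) \<ge> - c k)) \<and>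
        (\<exists>\<alpha>>0. \<exists>P. \<forall>k. P k \<in> priors (M (r k)) \<and>
           measure (P k) {\<omega> \<in> space (ext_space (M (r k))).
             H k * (S1 (M (r k)) \<omega> - S0 (M (r k)) \<omega>) \<ge> \<alpha>} \<ge> \<alpha>))"

definition NAA1 :: "(nat \<Rightarrow> market) \<Rightarrow> bool" where
  "NAA1 M \<longleftrightarrow> \<not> AA1 M"

text \<open>\<open>contiguous M P Q\<close> means \<open>(P\<^sup>n) \<triangleleft> (Q\<^sup>n)\<close>.\<close>

definition contiguous ::
  "(nat \<Rightarrow> market) \<Rightarrow> (nat \<Rightarrow> real measure) \<Rightarrow> (nat \<Rightarrow> real measure) \<Rightarrow> bool" where
  "contiguous M P Q \<longleftrightarrow>
     (\<forall>A. (\<forall>n. A n \<in> sets (ext_space (M n))) \<longrightarrow>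
        (\<lambda>n. measure (Q n) (A n)) \<longlonglongrightarrow> 0 \<longrightarrow> (\<lambda>n. measure (P n) (A n)) \<longlonglongrightarrow> 0)"

end

theory Submission
  imports Defs "HOL-Probability.Probability_Mass_Function"
begin

text \<open>Every prior is carried by countably many states, so it is given by a probability mass
  function, and its extension to the enlarged \<open>\<sigma>\<close>-algebra is given by the same mass function: the
  sets \<open>S\<^sub>R\<close> cover all charged states, because the two families of priors have the same null sets.

  If \<open>d = 1\<close> (or \<open>U = 1\<close>), buying (or selling) one share has asymptotically vanishing losses, and the
  nondegeneracy assumption supplies priors under which the gain does not vanish. If \<open>d < 1 < U\<close>, a
  prior with mean price above (below) \<open>1\<close> becomes a martingale measure after mixing it with a point
  mass at the lowest (highest) price. The weight \<open>s\<^sub>n\<close> of the prior in this mixture stays away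
  from \<open>0\<close>, so \<open>s\<^sub>n P\<^sup>n \<le> Q\<^sup>n\<close> gives contiguity. Finally, a martingale measure assigns mass at most
  \<open>c / \<alpha>\<close> to the event that a position with loss bounded by \<open>c\<close> gains \<open>\<alpha>\<close>, so contiguity excludes
  an asymptotic arbitrage.\<close>

section \<open>Measures given by mass functions\<close>

text \<open>A mass function lives on the power set of the whole type. Restricting it to
  \<open>space N\<close> makes the identity a measurable map into \<open>N\<close>, and the image
  measure then forgets all events outside \<open>sets N\<close>. The same \<open>p\<close> can thus
  be read on \<open>pos_borel\<close> and on \<open>ext_space m\<close>.\<close>

definition pmf_on :: "'a measure \<Rightarrow> 'a pmf \<Rightarrow> 'a measure" where
  "pmf_on N p = distr (restrict_space (measure_pmf p) (space N)) N (\<lambda>\<omega>. \<omega>)"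

lemma sets_pmf_on [simp, measurable_cong]: "sets (pmf_on N p) = sets N"
  and space_pmf_on [simp]: "space (pmf_on N p) = space N"
  by (simp_all add: pmf_on_def)

lemma measurable_restrict_pmf:
  "(\<lambda>\<omega>. \<omega>) \<in> measurable (restrict_space (measure_pmf p) (space N)) N"
  by (rule measurableI) (use sets.sets_into_space in \<open>auto simp: space_restrict_space sets_restrict_space image_iff\<close>)

lemma emeasure_pmf_on:
  assumes "A \<in> sets N"
  shows "emeasure (pmf_on N p) A = emeasure (measure_pmf p) A"
proof -
  have "emeasure (pmf_on N p) A = emeasure (restrict_space (measure_pmf p) (space N)) (A \<inter> space N)"
    unfolding pmf_on_def using assms
    by (subst emeasure_distr[OF measurable_restrict_pmf]) (auto simp: space_restrict_space)
  also have "\<dots> = emeasure (measure_pmf p) A"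
    using sets.sets_into_space[OF assms]
    by (subst emeasure_restrict_space) (auto simp: Int_absorb2)
  finally show ?thesis .
qed

lemma measure_pmf_on:
  "A \<in> sets N \<Longrightarrow> measure (pmf_on N p) A = measure_pmf.prob p A"
  by (simp add: measure_def emeasure_pmf_on)

lemma prob_space_pmf_on: "set_pmf p \<subseteq> space N \<Longrightarrow> prob_space (pmf_on N p)"
  by (rule prob_spaceI)
    (simp add: emeasure_pmf_on, metis AE_measure_pmf_iff measure_pmf.emeasure_eq_1_AE
      UNIV_I sets_measure_pmf subsetD)

lemma integrable_pmf_on:
  fixes f :: "'a \<Rightarrow> real"
  assumes "set_pmf p \<subseteq> space N" "f \<in> borel_measurable N"
    "\<And>\<omega>. \<omega> \<in> set_pmf p \<Longrightarrow> \<bar>f \<omega>\<bar> \<le> B"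
  shows "integrable (pmf_on N p) f"
proof -
  interpret prob_space "pmf_on N p" by (rule prob_space_pmf_on) fact
  have m: "{\<omega> \<in> space N. \<bar>f \<omega>\<bar> \<le> B} \<in> sets N" using assms(2) by measurable
  have "emeasure (pmf_on N p) {\<omega> \<in> space N. \<bar>f \<omega>\<bar> \<le> B} = 1"
    unfolding emeasure_pmf_on[OF m] using assms
    by (subst measure_pmf.emeasure_eq_1_AE) (auto simp: AE_measure_pmf_iff)
  then have "AE \<omega> in pmf_on N p. \<omega> \<in> {\<omega> \<in> space N. \<bar>f \<omega>\<bar> \<le> B}"
    using m by (intro AE_prob_1) (simp add: emeasure_eq_measure)
  then have "AE \<omega> in pmf_on N p. norm (f \<omega>) \<le> B" by (rule AE_mp) simp
  then show ?thesis using assms(2) by (intro integrable_const_bound) auto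
qed

lemma integral_pmf_on:
  fixes f :: "'a \<Rightarrow> real"
  assumes "set_pmf p \<subseteq> space N" "f \<in> borel_measurable N"
  shows "integral\<^sup>L (pmf_on N p) f = measure_pmf.expectation p f"
proof -
  have "integral\<^sup>L (pmf_on N p) f = (\<integral>\<omega>. indicator (space N) \<omega> *\<^sub>R f \<omega> \<partial>measure_pmf p)"
    unfolding pmf_on_def using assms
    by (subst integral_distr[OF measurable_restrict_pmf]) (auto simp: integral_restrict_space)
  also have "\<dots> = measure_pmf.expectation p f"
    using assms by (intro integral_cong_AE) (auto simp: AE_measure_pmf_iff)
  finally show ?thesis .
qed

text \<open>An event is null under a mass function exactly when it misses the support, so an
  inclusion of supports passes null events on.\<close>

lemma absolutely_continuous_pmf_on:
  assumes "set_pmf q \<subseteq> set_pmf p"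
  shows "absolutely_continuous (pmf_on N p) (pmf_on N q)"
proof -
  have "emeasure (measure_pmf q) A = 0" if "emeasure (measure_pmf p) A = 0" for A
  proof -
    have "A \<in> null_sets (measure_pmf p)" using that by auto
    then have "AE x in measure_pmf p. x \<notin> A" by (rule AE_not_in)
    then have "AE x in measure_pmf q. x \<notin> A" using assms by (auto simp: AE_measure_pmf_iff)
    then show ?thesis by (simp add: AE_iff_null_sets[symmetric] null_setsD1)
  qed
  then show ?thesis by (auto simp: absolutely_continuous_def null_sets_def emeasure_pmf_on)
qed

text \<open>Priors, mixtures and extensions are introduced through \<open>measure_of\<close> with an
  explicit formula. A formula that agrees with a genuine measure on the generated \<sigma>-algebra
  inherits countable additivity from it, so none has to be verified for the formula itself.\<close>

lemma measure_of_eq_pmf_on: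
  assumes "G \<subseteq> Pow (space N)" "sets N = sigma_sets (space N) G"
    "\<And>A. A \<in> sets N \<Longrightarrow> \<mu> A = emeasure (measure_pmf p) A"
  shows "measure_of (space N) G \<mu> = pmf_on N p"
proof -
  have "measure_of (space N) G \<mu> = measure_of (space N) G (emeasure (pmf_on N p))"
    using assms by (intro measure_of_eq) (auto simp: emeasure_pmf_on)
  also have "\<dots> = measure_of (space N) (sets N) (emeasure (pmf_on N p))"
    unfolding measure_of_def using assms(1,2) sets.space_closed[of N]
    by (simp add: sets.sigma_sets_eq flip: assms(2))
  also have "\<dots> = pmf_on N p"
    using measure_of_of_measure[of "pmf_on N p"] by simp
  finally show ?thesis .
qed

lemma measure_of_sets_eq_pmf_on:
  assumes "\<And>A. A \<in> sets N \<Longrightarrow> \<mu> A = emeasure (measure_pmf p) A"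
  shows "measure_of (space N) (sets N) \<mu> = pmf_on N p"
  using assms by (intro measure_of_eq_pmf_on) (auto simp: sets.space_closed sets.sigma_sets_eq)

text \<open>Countable additivity for an index set of priors instead of the natural numbers, as the
  sum in \<open>ext_measure\<close> requires. Enumerating \<open>J\<close> and padding with empty
  sets reduces it to the sequential form and covers finite \<open>J\<close> as well.\<close>

lemma infsum_emeasure:
  assumes J: "countable J" and X: "\<And>i. i \<in> J \<Longrightarrow> X i \<in> sets M" and disj: "disjoint_family_on X J"
  shows "(\<Sum>\<^sub>\<infinity>i\<in>J. emeasure M (X i)) = emeasure M (\<Union>(X ` J))"
proof -
  let ?T = "to_nat_on J ` J"
  define Y where "Y n = (if n \<in> ?T then X (from_nat_into J n) else {})" for n
  have XY: "X i = Y (to_nat_on J i)" if "i \<in> J" for i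
    using that J by (simp add: Y_def)
  have Yd: "disjoint_family Y"
    using disj J inj_on_to_nat_on[OF J]
    by (fastforce simp: disjoint_family_on_def Y_def)
  have "(\<Sum>\<^sub>\<infinity>i\<in>J. emeasure M (X i)) = (\<Sum>\<^sub>\<infinity>i\<in>J. ((\<lambda>n. emeasure M (Y n)) \<circ> to_nat_on J) i)"
    using XY by (intro infsum_cong) simp
  also have "\<dots> = (\<Sum>\<^sub>\<infinity>n\<in>?T. emeasure M (Y n))"
    by (rule infsum_reindex[symmetric]) (rule inj_on_to_nat_on[OF J])
  also have "\<dots> = (\<Sum>\<^sub>\<infinity>n. emeasure M (Y n))"
    by (rule infsum_cong_neutral) (auto simp: Y_def)
  also have "\<dots> = (\<Sum>n. emeasure M (Y n))"
    by (intro sums_unique has_sum_imp_sums has_sum_infsum nonneg_summable_on_complete) simp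
  also have "\<dots> = emeasure M (\<Union>n. Y n)"
    using X J by (intro suminf_emeasure Yd) (auto simp: Y_def)
  also have "(\<Union>n. Y n) = \<Union>(X ` J)"
    using XY by (auto simp: Y_def split: if_splits)
  finally show ?thesis .
qed

section \<open>Two-point mass functions\<close>

definition two_point_pmf :: "'a \<Rightarrow> 'a \<Rightarrow> real \<Rightarrow> 'a pmf" where
  "two_point_pmf x y p = map_pmf (\<lambda>b. if b then x else y) (bernoulli_pmf p)"

lemma emeasure_two_point_pmf:
  assumes "0 \<le> p" "p \<le> 1"
  shows "emeasure (measure_pmf (two_point_pmf x y p)) A =
    ennreal p * indicator A x + ennreal (1 - p) * indicator A y"
proof -
  have "emeasure (measure_pmf (two_point_pmf x y p)) A =
     emeasure (measure_pmf (bind_pmf (bernoulli_pmf p) (\<lambda>b. return_pmf (if b then x else y)))) A"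
    by (simp add: two_point_pmf_def map_pmf_def comp_def)
  also have "\<dots> = ennreal p * indicator A x + ennreal (1 - p) * indicator A y"
    using assms by (simp only: emeasure_bind_pmf) (simp add: mult.commute)
  finally show ?thesis .
qed

lemma set_two_point_pmf: "0 < p \<Longrightarrow> p < 1 \<Longrightarrow> set_pmf (two_point_pmf x y p) = {x, y}"
  by (auto simp: two_point_pmf_def)

section \<open>Priors as mass functions\<close>

lemma space_pos_borel [simp]: "space pos_borel = {0<..}"
  by (simp add: pos_borel_def)

lemma finite_in_sets_pos_borel: "finite A \<Longrightarrow> A \<subseteq> {0<..} \<Longrightarrow> A \<in> sets pos_borel"
  by (auto simp: pos_borel_def sets_restrict_space Int_absorb1 intro!: image_eqI[of A] borel_closed finite_imp_closed)

lemma two_point_eq: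
  assumes "0 \<le> p" "p \<le> 1"
  shows "two_point x y p = pmf_on pos_borel (two_point_pmf x y p)"
  unfolding two_point_def using assms
  by (intro measure_of_sets_eq_pmf_on) (simp add: emeasure_two_point_pmf)

text \<open>A countable mixture is a two-stage experiment: draw an index with weights \<alpha>, then
  a state from the selected component. This is the monadic bind.\<close>

lemma countable_mixture_pmf_on:
  assumes "\<And>k. 0 \<le> \<alpha> k" "\<alpha> sums 1"
  shows "countable_mixture \<alpha> (\<lambda>k. pmf_on pos_borel (q k)) =
    pmf_on pos_borel (bind_pmf (embed_pmf \<alpha>) q)"
proof -
  have "(\<integral>\<^sup>+k. ennreal (\<alpha> k) \<partial>count_space UNIV) = 1"
    using assms by (simp add: nn_integral_count_space_nat suminf_ennreal2 sums_iff)
  then have pmf: "pmf (embed_pmf \<alpha>) k = \<alpha> k" for k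
    using assms by (intro pmf_embed_pmf) auto
  show ?thesis
    unfolding countable_mixture_def
    by (intro measure_of_sets_eq_pmf_on)
      (simp add: emeasure_pmf_on nn_integral_measure_pmf pmf nn_integral_count_space_nat)
qed

section \<open>The enlarged \<sigma>-algebra and a single market\<close>

lemma space_ext_space [simp]: "space (ext_space m) = {0<..}"
  by (simp add: ext_space_def space_measure_of_conv)

lemma carrier_set_subset: "carrier_set m R \<subseteq> {0<..}"
  by (auto simp: carrier_set_def split: prod.splits)

lemma ext_generator_subset: "ext_generator m \<subseteq> Pow {0<..}"
  using sets.sets_into_space[of _ pos_borel] by (fastforce simp: ext_generator_def)

lemma sets_ext_space: "sets (ext_space m) = sigma_sets {0<..} (ext_generator m)"
  using ext_generator_subset by (simp add: ext_space_def)

lemma sets_pos_borel_subset_ext: "A \<in> sets pos_borel \<Longrightarrow> A \<in> sets (ext_space m)"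
  by (auto simp: sets_ext_space ext_generator_def)

lemma measurable_ext_space: "f \<in> borel_measurable pos_borel \<Longrightarrow> f \<in> borel_measurable (ext_space m)"
  unfolding measurable_def by (auto intro: sets_pos_borel_subset_ext)

text \<open>Collects what is assumed of one market at a fixed time index; the limits in (A3) and
  (A4) enter only in the final theorem.\<close>

locale binomial_market =
  fixes m :: market
  assumes valid: "valid_market m"
    and p_bounds: "0 < p_low m" "p_low m \<le> p_high m" "p_high m < 1"
    and ordered: "d_low m \<le> d_high m" "u_low m \<le> u_high m"
    and d_low_bounds: "0 < d_low m" "d_low m < 1"
    and u_high_bound: "1 < u_high m"
    and strict: "d_low m < u_low m" "d_high m < u_high m"
begin

lemma measurable_price: "price m \<in> measurable pos_borel pos_borel"
  and bij_price: "bij_betw (price m) {0<..} {0<..}"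
  and Rtilde_subset: "Rtilde m \<subseteq> two_point_priors m"
  and disjoint_carriers: "disjoint_family_on (carrier_set m) (Rtilde m)"
  using valid by (simp_all add: valid_market_def)

lemma measurable_S1 [measurable]: "S1 m \<in> borel_measurable (ext_space m)"
proof -
  have "(\<lambda>x. x) \<in> measurable pos_borel borel"
    unfolding pos_borel_def by (rule measurable_restrict_space1) simp
  then have "(\<lambda>\<omega>. price m \<omega>) \<in> measurable pos_borel borel"
    using measurable_compose[OF measurable_price] by blast
  then show ?thesis by (intro measurable_ext_space) (simp add: S1_def[abs_def])
qed

lemma price_pos: "0 < \<omega> \<Longrightarrow> 0 < price m \<omega>"
  using bij_betwE[OF bij_price] by auto

text \<open>As the price map is a bijection of the half-line, a state can be named by the price it
  realises. Two-point laws of the price thereby become two-point distributions of the state.\<close>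

definition state :: "real \<Rightarrow> real" where
  "state = the_inv_into {0<..} (price m)"

lemma state_pos: "0 < s \<Longrightarrow> 0 < state s"
  using bij_betwE[OF bij_betw_the_inv_into[OF bij_price]] by (auto simp: state_def)

lemma price_state [simp]: "0 < s \<Longrightarrow> price m (state s) = s"
  using f_the_inv_into_f_bij_betw[OF bij_price] by (auto simp: state_def)

lemma state_price [simp]: "0 < \<omega> \<Longrightarrow> state (price m \<omega>) = \<omega>"
  using the_inv_into_f_f[OF bij_betw_imp_inj_on[OF bij_price]] by (auto simp: state_def)

text \<open>The common price range follows from (A2): an up price is at least
  \<open>u_low m\<close>, which exceeds \<open>d_low m\<close>, and a down price is at most
  \<open>d_high m\<close>, which lies below \<open>u_high m\<close>.\<close>

lemma param_boxD:
  assumes "(x, y, p) \<in> param_box m"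
  shows "0 < x" "0 < y" "0 < p" "p < 1"
    "d_low m \<le> x" "x \<le> u_high m" "d_low m \<le> y" "y \<le> u_high m"
  using assms p_bounds d_low_bounds strict ordered by (auto simp: param_box_def)

definition box_pmfs :: "real pmf set" where
  "box_pmfs = {two_point_pmf (state x) (state y) p | x y p. (x, y, p) \<in> param_box m}"

lemma law_two_point:
  assumes "(x, y, p) \<in> param_box m"
  shows "law m (pmf_on pos_borel (two_point_pmf (state x) (state y) p)) = two_point x y p"
proof (rule measure_eqI)
  note b = param_boxD[OF assms]
  show "sets (law m (pmf_on pos_borel (two_point_pmf (state x) (state y) p))) = sets (two_point x y p)"
    using b by (simp add: law_def two_point_eq)
  fix A assume "A \<in> sets (law m (pmf_on pos_borel (two_point_pmf (state x) (state y) p)))"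
  then have A: "A \<in> sets pos_borel" by (simp add: law_def)
  have meas: "price m -` A \<inter> {0<..} \<in> sets pos_borel"
    using measurable_sets[OF measurable_price A] by simp
  have "price m \<in> measurable (pmf_on pos_borel (two_point_pmf (state x) (state y) p)) pos_borel"
    using measurable_price by (simp cong: measurable_cong_sets)
  then show "emeasure (law m (pmf_on pos_borel (two_point_pmf (state x) (state y) p))) A =
      emeasure (two_point x y p) A"
    using b A state_pos meas
    by (simp add: law_def emeasure_distr two_point_eq emeasure_pmf_on emeasure_two_point_pmf
        indicator_def)
qed

text \<open>The law determines the mass of each subset of the at most two states that carry \<open>R\<close>; arguing
  on these finite sets avoids the measurability of the inverse of \<^term>\<open>price m\<close>.\<close>

lemma prior_eq_of_law:
  assumes "prob_space R" and sets: "sets R = sets pos_borel"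
    and law: "law m R = two_point x y p" and box: "(x, y, p) \<in> param_box m"
  shows "R = pmf_on pos_borel (two_point_pmf (state x) (state y) p)"
proof (rule measure_eqI)
  interpret prob_space R by fact
  note b = param_boxD[OF box]
  let ?q = "two_point_pmf (state x) (state y) p"
  let ?S = "{state x, state y}"
  have spc: "space R = {0<..}" using sets_eq_imp_space_eq[OF sets] by simp
  have pm: "price m \<in> measurable R pos_borel"
    using measurable_price sets by (simp cong: measurable_cong_sets)
  have R: "emeasure R B = emeasure (measure_pmf ?q) B" if "B \<subseteq> ?S" for B
  proof -
    have fin: "finite (price m ` B)" using that by (meson finite.emptyI finite.insertI finite_imageI finite_subset)
    have Bpos: "B \<subseteq> {0<..}" using that b state_pos by auto
    then have im: "price m ` B \<in> sets pos_borel"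
      using fin price_pos by (intro finite_in_sets_pos_borel) auto
    have pre: "price m -` (price m ` B) \<inter> {0<..} = B"
      using Bpos bij_betw_imp_inj_on[OF bij_price] by (auto simp: inj_on_def)
    have "emeasure R B = emeasure (law m R) (price m ` B)"
      using pm im pre by (simp add: law_def emeasure_distr spc)
    also have "\<dots> = emeasure (law m (pmf_on pos_borel ?q)) (price m ` B)"
      by (simp add: law law_two_point[OF box])
    also have "\<dots> = emeasure (pmf_on pos_borel ?q) B"
      using measurable_price im pre by (simp add: law_def emeasure_distr cong: measurable_cong_sets)
    also have "\<dots> = emeasure (measure_pmf ?q) B"
      using Bpos that by (intro emeasure_pmf_on finite_in_sets_pos_borel) (auto intro: finite_subset)
    finally show ?thesis .
  qed
  show "sets R = sets (pmf_on pos_borel ?q)" by (simp add: sets)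
  fix A assume A: "A \<in> sets R"
  have S: "?S \<in> sets R"
    unfolding sets using b state_pos by (intro finite_in_sets_pos_borel) auto
  \<comment> \<open>The two states carry the full mass of \<open>R\<close>, so every event may be
    replaced by its trace on them, where \<open>R\<close> is already known.\<close>
  have "emeasure R ?S = 1"
    using R[of ?S] b by (simp add: emeasure_two_point_pmf indicator_def flip: ennreal_plus)
  then have ae: "AE \<omega> in R. \<omega> \<in> ?S" using S by (intro AE_prob_1) (simp add: emeasure_eq_measure)
  have "emeasure R A = emeasure R (A \<inter> ?S)"
  proof (rule emeasure_eq_AE)
    show "AE \<omega> in R. \<omega> \<in> A \<longleftrightarrow> \<omega> \<in> A \<inter> ?S" using ae by (rule AE_mp) simp
  qed (use A S in auto)
  also have "\<dots> = emeasure (measure_pmf ?q) (A \<inter> ?S)" by (rule R) simp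
  also have "\<dots> = emeasure (measure_pmf ?q) A"
    using b by (simp add: emeasure_two_point_pmf indicator_def)
  also have "\<dots> = emeasure (pmf_on pos_borel ?q) A"
    using A sets by (simp add: emeasure_pmf_on)
  finally show "emeasure R A = emeasure (pmf_on pos_borel ?q) A" .
qed

lemma set_box_pmf_pos:
  assumes "q \<in> box_pmfs"
  shows "set_pmf q \<subseteq> {0<..}"
proof -
  obtain x y p where box: "(x, y, p) \<in> param_box m"
    and q: "q = two_point_pmf (state x) (state y) p"
    using assms by (auto simp: box_pmfs_def)
  show ?thesis using param_boxD[OF box] state_pos by (auto simp: q set_two_point_pmf)
qed

lemma two_point_priors_eq: "two_point_priors m = pmf_on pos_borel ` box_pmfs"
proof (intro equalityI subsetI)
  fix R assume "R \<in> two_point_priors m"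
  then obtain x y p where "prob_space R" "sets R = sets pos_borel" "law m R = two_point x y p"
      "(x, y, p) \<in> param_box m"
    by (auto simp: two_point_priors_def laws_def)
  then show "R \<in> pmf_on pos_borel ` box_pmfs"
    using prior_eq_of_law[of R x y p] unfolding box_pmfs_def by blast
next
  fix R assume "R \<in> pmf_on pos_borel ` box_pmfs"
  then obtain x y p where box: "(x, y, p) \<in> param_box m"
    and R: "R = pmf_on pos_borel (two_point_pmf (state x) (state y) p)"
    by (auto simp: box_pmfs_def)
  have "prob_space R"
    unfolding R by (rule prob_space_pmf_on)
      (use param_boxD[OF box] state_pos in \<open>simp add: set_two_point_pmf\<close>)
  then show "R \<in> two_point_priors m"
    using law_two_point[OF box] box by (auto simp: two_point_priors_def laws_def R)
qed

text \<open>\<open>params_of\<close> selects one representation of the law by choice. Whichever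
  triple it returns, the law determines the prior, and the two named states form the
  carrier.\<close>

lemma params_of_prior:
  assumes "R \<in> two_point_priors m"
  obtains x y p where "(x, y, p) \<in> param_box m"
    "R = pmf_on pos_borel (two_point_pmf (state x) (state y) p)"
    "carrier_set m R = {state x, state y}"
proof -
  obtain x y p where xyp: "params_of m R = (x, y, p)" by (cases "params_of m R")
  have "\<exists>t. t \<in> param_box m \<and> (case t of (x, y, p) \<Rightarrow> law m R = two_point x y p)"
    using assms by (auto simp: two_point_priors_def laws_def)
  from someI_ex[OF this] have t: "(x, y, p) \<in> param_box m" "law m R = two_point x y p"
    using xyp by (auto simp: params_of_def)
  show ?thesis
  proof (rule that[OF t(1)])
    show "R = pmf_on pos_borel (two_point_pmf (state x) (state y) p)"
      using assms by (intro prior_eq_of_law t) (simp_all add: two_point_priors_def)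
    have "0 < \<omega> \<and> price m \<omega> = s \<longleftrightarrow> \<omega> = state s" if "0 < s" for \<omega> s
      using that state_pos[OF that] by auto
    then show "carrier_set m R = {state x, state y}"
      using param_boxD(1,2)[OF t(1)] unfolding carrier_set_def xyp by auto
  qed
qed

lemma carrier_in_sets:
  assumes "R \<in> Rtilde m"
  shows "A \<inter> carrier_set m R \<in> sets pos_borel"
proof -
  from assms Rtilde_subset have "R \<in> two_point_priors m" by auto
  then have "finite (carrier_set m R)" by (rule params_of_prior) simp
  then show ?thesis using carrier_set_subset[of m R] by (intro finite_in_sets_pos_borel) auto
qed

section \<open>Countable mixtures and their extensions\<close>

definition prior_pmfs :: "real pmf set" where
  "prior_pmfs = {bind_pmf a q | (a :: nat pmf) q. \<forall>k. q k \<in> box_pmfs}"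

text \<open>A charged state is a singleton that some two-point prior does not regard as null. By the
  equality of null sets some member of \<open>Rtilde m\<close> charges it too, and that member is
  carried by its own carrier set.\<close>

lemma set_prior_pmf_covered:
  assumes "p \<in> prior_pmfs" "\<omega> \<in> set_pmf p"
  obtains R where "R \<in> Rtilde m" "\<omega> \<in> carrier_set m R"
proof -
  obtain q where q: "q \<in> box_pmfs" "\<omega> \<in> set_pmf q"
    using assms unfolding prior_pmfs_def by (auto simp del: set_bind_pmf simp: set_bind_pmf) blast
  then have pos: "{\<omega>} \<in> sets pos_borel"
    using set_box_pmf_pos by (intro finite_in_sets_pos_borel) auto
  have "emeasure (pmf_on pos_borel q) {\<omega>} \<noteq> 0"
    using q pos by (simp add: emeasure_pmf_on emeasure_pmf_single_eq_zero_iff)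
  moreover have "pmf_on pos_borel q \<in> two_point_priors m"
    using q by (simp add: two_point_priors_eq)
  ultimately obtain R where R: "R \<in> Rtilde m" "emeasure R {\<omega>} \<noteq> 0"
    using valid pos unfolding valid_market_def by meson
  have "\<omega> \<in> carrier_set m R"
  proof -
    from R(1) Rtilde_subset have "R \<in> two_point_priors m" by auto
    then obtain x y p where "(x, y, p) \<in> param_box m"
      "R = pmf_on pos_borel (two_point_pmf (state x) (state y) p)"
      "carrier_set m R = {state x, state y}"
      by (rule params_of_prior)
    then show ?thesis using R(2) pos param_boxD[of x y p]
      by (auto simp: emeasure_pmf_on emeasure_pmf_single_eq_zero_iff set_two_point_pmf)
  qed
  with R(1) show ?thesis by (rule that)
qed

lemma borel_priors_eq: "borel_priors m = pmf_on pos_borel ` prior_pmfs"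
proof (intro equalityI subsetI)
  fix P assume "P \<in> borel_priors m"
  then obtain \<alpha> R where P: "P = countable_mixture \<alpha> R" and R: "\<And>k. R k \<in> two_point_priors m"
    and \<alpha>: "\<And>k. 0 \<le> \<alpha> k" "\<alpha> sums 1"
    by (auto simp: borel_priors_def)
  from R have "\<forall>k. \<exists>q. q \<in> box_pmfs \<and> R k = pmf_on pos_borel q"
    by (auto simp: two_point_priors_eq image_iff)
  then obtain q where q: "\<And>k. q k \<in> box_pmfs" "\<And>k. R k = pmf_on pos_borel (q k)"
    by metis
  then have "R = (\<lambda>k. pmf_on pos_borel (q k))" by auto
  then show "P \<in> pmf_on pos_borel ` prior_pmfs"
    using countable_mixture_pmf_on[OF \<alpha>] q by (auto simp: P prior_pmfs_def)
next
  fix P assume "P \<in> pmf_on pos_borel ` prior_pmfs"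
  then obtain a :: "nat pmf" and q where q: "\<And>k. q k \<in> box_pmfs"
    and P: "P = pmf_on pos_borel (bind_pmf a q)"
    by (auto simp: prior_pmfs_def)
  \<comment> \<open>The index distribution is turned back into a weight sequence; total mass one as
    an integral over the indices becomes a series with sum one.\<close>
  have one: "(\<integral>\<^sup>+k. ennreal (pmf a k) \<partial>count_space UNIV) = 1"
    by (simp add: nn_integral_pmf)
  have "(\<lambda>k. ennreal (pmf a k)) sums (\<Sum>k. ennreal (pmf a k))"
    by (rule summable_sums) (rule summableI)
  then have "(\<lambda>k. ennreal (pmf a k)) sums ennreal 1"
    using one by (simp only: nn_integral_count_space_nat ennreal_1)
  then have "pmf a sums 1"
    by (subst (asm) sums_ennreal) (simp_all add: pmf_nonneg)
  moreover have "embed_pmf (pmf a) = a"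
    by (intro pmf_eqI pmf_embed_pmf pmf_nonneg one)
  ultimately have "P = countable_mixture (pmf a) (\<lambda>k. pmf_on pos_borel (q k))"
    using countable_mixture_pmf_on[of "pmf a" q] by (simp add: P pmf_nonneg)
  moreover have "\<forall>k. pmf_on pos_borel (q k) \<in> two_point_priors m"
    using q by (simp add: two_point_priors_eq)
  moreover have "\<forall>k. 0 \<le> pmf a k \<and> pmf a k \<le> 1"
    by (simp add: pmf_nonneg pmf_le_1)
  ultimately show "P \<in> borel_priors m"
    using \<open>pmf a sums 1\<close> unfolding borel_priors_def by blast
qed

text \<open>The carriers charged by \<open>p\<close> are countably many, disjoint, and cover the
  support of \<open>p\<close>. Summing the mass of \<open>A\<close> over them therefore returns the
  mass of \<open>A\<close> under \<open>p\<close>.\<close>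

lemma ext_measure_pmf_on:
  assumes "p \<in> prior_pmfs"
  shows "ext_measure m (pmf_on pos_borel p) = pmf_on (ext_space m) p"
proof -
  define J where "J = {R \<in> Rtilde m. emeasure (pmf_on pos_borel p) (carrier_set m R) \<noteq> 0}"
  have J_iff: "R \<in> J \<longleftrightarrow> R \<in> Rtilde m \<and> carrier_set m R \<inter> set_pmf p \<noteq> {}" for R
    using carrier_in_sets[of R UNIV]
    by (auto simp: J_def emeasure_pmf_on measure_pmf.emeasure_eq_measure measure_pmf_zero_iff)
  have disj: "disjoint_family_on (carrier_set m) J"
    using disjoint_carriers by (rule disjoint_family_on_mono[rotated]) (auto simp: J_def)
  \<comment> \<open>One support point is chosen in each charged carrier. Disjointness makes the
    choice injective, and the support of a mass function is countable.\<close>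
  have "countable J"
  proof -
    have "\<forall>R\<in>J. \<exists>\<omega>. \<omega> \<in> carrier_set m R \<inter> set_pmf p" using J_iff by auto
    then obtain w where w: "\<And>R. R \<in> J \<Longrightarrow> w R \<in> carrier_set m R \<inter> set_pmf p" by metis
    then have "inj_on w J" using disj by (fastforce simp: inj_on_def disjoint_family_on_def)
    moreover have "countable (w ` J)" using w by (intro countable_subset[OF _ countable_set_pmf[of p]]) auto
    ultimately show ?thesis by (rule countable_image_inj_on[rotated])
  qed
  have eq: "(\<Sum>\<^sub>\<infinity>R\<in>J. emeasure (pmf_on pos_borel p) (A \<inter> carrier_set m R)) = emeasure (measure_pmf p) A" for A
  proof -
    have "(\<Sum>\<^sub>\<infinity>R\<in>J. emeasure (pmf_on pos_borel p) (A \<inter> carrier_set m R)) =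
        (\<Sum>\<^sub>\<infinity>R\<in>J. emeasure (measure_pmf p) (A \<inter> carrier_set m R))"
      by (intro infsum_cong emeasure_pmf_on carrier_in_sets) (simp add: J_def)
    also have "\<dots> = emeasure (measure_pmf p) (\<Union>R\<in>J. A \<inter> carrier_set m R)"
      using \<open>countable J\<close> disj by (intro infsum_emeasure) (auto simp: disjoint_family_on_def)
    \<comment> \<open>The charged carriers cover the support, so \<open>A\<close> and its trace on
      their union differ by a null set only.\<close>
    also have "\<dots> = emeasure (measure_pmf p) A"
    proof (intro emeasure_eq_AE AE_pmfI)
      fix \<omega> assume "\<omega> \<in> set_pmf p"
      moreover from assms this obtain R where "R \<in> Rtilde m" "\<omega> \<in> carrier_set m R"
        by (rule set_prior_pmf_covered)
      ultimately have "R \<in> J" "\<omega> \<in> carrier_set m R" by (auto simp: J_iff)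
      then show "\<omega> \<in> (\<Union>R\<in>J. A \<inter> carrier_set m R) \<longleftrightarrow> \<omega> \<in> A" by auto
    qed auto
    finally show ?thesis .
  qed
  show ?thesis
    unfolding ext_measure_def J_def[symmetric] eq space_pos_borel space_ext_space[of m, symmetric]
    by (rule measure_of_eq_pmf_on) (simp_all add: ext_generator_subset sets_ext_space)
qed

lemma priors_eq: "priors m = pmf_on (ext_space m) ` prior_pmfs"
  using ext_measure_pmf_on by (simp add: priors_def borel_priors_eq image_image)

end

section \<open>Martingale measures\<close>

lemma ext_expectation_integrable:
  assumes "integrable Q f"
  shows "ext_expectation Q f = ereal (integral\<^sup>L Q f)"
proof -
  have max0: "ennreal (max 0 x) = ennreal x" for x :: real
    by (simp add: max_def ennreal_neg)
  obtain r q where r: "0 \<le> r" "(\<integral>\<^sup>+x. ennreal (f x) \<partial>Q) = ennreal r"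
    and q: "0 \<le> q" "(\<integral>\<^sup>+x. ennreal (- f x) \<partial>Q) = ennreal q"
    and f: "integral\<^sup>L Q f = r - q"
    using assms by (rule integrableE)
  show ?thesis
    using r(1) q(1) by (simp add: ext_expectation_def max0 r(2) q(2) f enn2ereal_ennreal)
qed

text \<open>Under the stated convention an infinite negative part forces the value minus infinity,
  and an infinite positive part beside a finite negative part forces plus infinity. A real value
  excludes both.\<close>

lemma integrable_of_ext_expectation:
  assumes f: "f \<in> borel_measurable Q" and E: "ext_expectation Q f = ereal a"
  shows "integrable Q f" "integral\<^sup>L Q f = a"
proof -
  have max0: "ennreal (max 0 x) = ennreal x" for x :: real
    by (simp add: max_def ennreal_neg)
  have neg: "(\<integral>\<^sup>+x. ennreal (- f x) \<partial>Q) \<noteq> \<infinity>"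
    using E by (auto simp: ext_expectation_def max0)
  have "(\<integral>\<^sup>+x. ennreal (f x) \<partial>Q) \<noteq> \<infinity>"
    using E neg by (auto simp: ext_expectation_def max0)
  with neg show int: "integrable Q f"
    using f by (simp add: real_integrable_def)
  show "integral\<^sup>L Q f = a"
    using ext_expectation_integrable[OF int] E by simp
qed

section \<open>Mixing two mass functions\<close>

lemma prob_bernoulli_mix:
  assumes "0 \<le> t" "t \<le> 1"
  shows "measure_pmf.prob (bind_pmf (bernoulli_pmf t) (\<lambda>b. if b then p else r)) A =
    t * measure_pmf.prob p A + (1 - t) * measure_pmf.prob r A"
proof -
  have "emeasure (measure_pmf (bind_pmf (bernoulli_pmf t) (\<lambda>b. if b then p else r))) A =
      ennreal t * emeasure p A + ennreal (1 - t) * emeasure r A"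
    using assms by (simp only: emeasure_bind_pmf) (simp add: mult.commute)
  also have "\<dots> = ennreal (t * measure_pmf.prob p A + (1 - t) * measure_pmf.prob r A)"
    using assms by (simp add: measure_pmf.emeasure_eq_measure flip: ennreal_mult)
  finally show ?thesis
    using assms by (simp add: measure_pmf.emeasure_eq_measure measure_nonneg del: ennreal_plus)
qed

text \<open>For \<open>f\<close> nonnegative on the support, the mixture splits at the level of
  nonnegative integrals. The finite value found there yields integrability under the mixture
  together with the formula.\<close>

lemma expectation_bernoulli_mix:
  fixes f :: "'a \<Rightarrow> real"
  assumes t: "0 \<le> t" "t \<le> 1" and p: "integrable (measure_pmf p) f"
    and pos: "\<And>\<omega>. \<omega> \<in> set_pmf p \<Longrightarrow> 0 \<le> f \<omega>" "0 \<le> f x"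
  shows "measure_pmf.expectation (bind_pmf (bernoulli_pmf t) (\<lambda>b. if b then p else return_pmf x)) f =
    t * measure_pmf.expectation p f + (1 - t) * f x" (is "measure_pmf.expectation ?q f = ?E")
proof -
  have Ep: "0 \<le> measure_pmf.expectation p f"
    using pos by (intro integral_nonneg_AE) (simp add: AE_measure_pmf_iff)
  have "(\<integral>\<^sup>+\<omega>. ennreal (f \<omega>) \<partial>measure_pmf p) = ennreal (measure_pmf.expectation p f)"
    using p pos by (intro nn_integral_eq_integral) (auto simp: AE_measure_pmf_iff)
  then have "(\<integral>\<^sup>+\<omega>. ennreal (f \<omega>) \<partial>measure_pmf ?q) =
      ennreal t * ennreal (measure_pmf.expectation p f) + ennreal (1 - t) * ennreal (f x)"
    using t by (simp only: nn_integral_bind_pmf) (simp add: mult.commute)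
  also have "\<dots> = ennreal ?E"
    using t pos Ep by (simp flip: ennreal_mult)
  finally have "integrable (measure_pmf ?q) f \<and> measure_pmf.expectation ?q f = ?E"
    using t pos Ep
    by (subst (asm) nn_integral_eq_integrable) (auto simp: AE_measure_pmf_iff split: if_splits)
  then show ?thesis ..
qed

context binomial_market
begin

lemma set_prior_pmf_price:
  assumes "p \<in> prior_pmfs" "\<omega> \<in> set_pmf p"
  shows "0 < \<omega>" "d_low m \<le> price m \<omega>" "price m \<omega> \<le> u_high m"
proof -
  obtain a :: "nat pmf" and q where q: "\<And>k. q k \<in> box_pmfs" and p: "p = bind_pmf a q"
    using assms by (auto simp: prior_pmfs_def)
  from assms(2) obtain k where w: "\<omega> \<in> set_pmf (q k)" by (auto simp: p)
  from q[of k] obtain x y t where box: "(x, y, t) \<in> param_box m"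
    and qk: "q k = two_point_pmf (state x) (state y) t"
    by (auto simp: box_pmfs_def)
  note b = param_boxD[OF box]
  have "\<omega> = state x \<or> \<omega> = state y" using w b by (simp add: qk set_two_point_pmf)
  then obtain s where s: "\<omega> = state s" "0 < s" "d_low m \<le> s" "s \<le> u_high m"
    using b by blast
  then show "0 < \<omega>" "d_low m \<le> price m \<omega>" "price m \<omega> \<le> u_high m"
    by (simp_all add: state_pos)
qed

lemma two_point_prior_pmf:
  assumes "(x, y, p) \<in> param_box m"
  shows "two_point_pmf (state x) (state y) p \<in> prior_pmfs"
proof -
  have "two_point_pmf (state x) (state y) p \<in> box_pmfs"
    using assms unfolding box_pmfs_def by blast
  then show ?thesis
    unfolding prior_pmfs_def
    by (intro CollectI exI[of _ "return_pmf 0"] exI[of _ "\<lambda>_. two_point_pmf (state x) (state y) p"])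
      (simp add: bind_return_pmf)
qed

lemma extreme_param: "(u_high m, d_low m, p_low m) \<in> param_box m"
  using ordered p_bounds by (simp add: param_box_def)

lemma priors_nonempty: "priors m \<noteq> {}"
  using two_point_prior_pmf[OF extreme_param] by (auto simp: priors_eq)

text \<open>The martingale measure built later may charge an extreme price that \<open>p\<close>
  misses. A prior with this larger support dominates it.\<close>

lemma prior_pmf_charging_extremes:
  assumes "p \<in> prior_pmfs"
  obtains p' where "p' \<in> prior_pmfs"
    "set_pmf p \<union> {state (u_high m), state (d_low m)} \<subseteq> set_pmf p'"
proof -
  let ?b = "two_point_pmf (state (u_high m)) (state (d_low m)) (p_low m)"
  obtain a :: "nat pmf" and q where q: "\<And>k. q k \<in> box_pmfs" and p: "p = bind_pmf a q"
    using assms by (auto simp: prior_pmfs_def)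
  \<comment> \<open>Shifting the old indices by \<open>Suc\<close> frees index 0 for the extreme
    two-point prior. Only the support matters, so any weight strictly between 0 and 1 could replace
    1/2.\<close>
  define a' where "a' = bind_pmf (bernoulli_pmf (1/2)) (\<lambda>h. if h then map_pmf Suc a else return_pmf 0)"
  define q' where "q' = case_nat ?b q"
  have "?b \<in> box_pmfs" using extreme_param by (auto simp: box_pmfs_def)
  then have "q' k \<in> box_pmfs" for k using q by (simp add: q'_def split: nat.split)
  then have "bind_pmf a' q' \<in> prior_pmfs" by (auto simp: prior_pmfs_def)
  moreover have "set_pmf a' = insert 0 (Suc ` set_pmf a)"
    by (simp add: a'_def UNIV_bool)
  then have "set_pmf (bind_pmf a' q') = set_pmf ?b \<union> set_pmf p"
    by (simp add: p q'_def)
  then have "set_pmf p \<union> {state (u_high m), state (d_low m)} \<subseteq> set_pmf (bind_pmf a' q')"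
    using p_bounds by (simp add: set_two_point_pmf)
  ultimately show ?thesis by (rule that)
qed

text \<open>No prior charges a state whose price leaves the range from \<open>d_low m\<close> to
  \<open>u_high m\<close>, so the exceptional set serves as its own null set.\<close>

lemma quasi_surelyI:
  assumes "\<And>\<omega>. 0 < \<omega> \<Longrightarrow> d_low m \<le> price m \<omega> \<Longrightarrow> price m \<omega> \<le> u_high m \<Longrightarrow> \<phi> \<omega>"
    and meas: "{\<omega> \<in> space (ext_space m). \<not> \<phi> \<omega>} \<in> sets (ext_space m)"
  shows "quasi_surely m \<phi>"
proof -
  have "emeasure P {\<omega> \<in> space (ext_space m). \<not> \<phi> \<omega>} = 0" if "P \<in> priors m" for P
  proof -
    obtain p where p: "p \<in> prior_pmfs" "P = pmf_on (ext_space m) p"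
      using \<open>P \<in> priors m\<close> by (auto simp: priors_eq)
    have "set_pmf p \<inter> {\<omega> \<in> space (ext_space m). \<not> \<phi> \<omega>} = {}"
      using assms(1) set_prior_pmf_price[OF p(1)] by auto
    then show ?thesis
      unfolding p(2) emeasure_pmf_on[OF meas]
      by (simp add: measure_pmf.emeasure_eq_measure measure_pmf_zero_iff)
  qed
  with meas show ?thesis unfolding quasi_surely_def by blast
qed

lemma martingale_measureD:
  assumes "Q \<in> martingale_measures m"
  shows "prob_space Q" "sets Q = sets (ext_space m)" "integrable Q (S1 m)" "integral\<^sup>L Q (S1 m) = 1"
proof -
  show Q: "prob_space Q" "sets Q = sets (ext_space m)"
    using assms by (simp_all add: martingale_measures_def)
  interpret prob_space Q by fact
  have [measurable]: "S1 m \<in> borel_measurable Q"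
    using measurable_S1 Q(2) by (simp cong: measurable_cong_sets)
  have "ext_expectation Q (\<lambda>\<omega>. S1 m \<omega> - 1) = ereal 0"
    using assms by (simp add: martingale_measures_def S0_def zero_ereal_def)
  note * = integrable_of_ext_expectation[OF _ this]
  have "integrable Q (\<lambda>\<omega>. S1 m \<omega> - 1)" by (rule *) simp
  then have "integrable Q (\<lambda>\<omega>. (S1 m \<omega> - 1) + 1)" by (intro Bochner_Integration.integrable_add) simp_all
  then show "integrable Q (S1 m)" by simp
  moreover have "(\<integral>\<omega>. S1 m \<omega> - 1 \<partial>Q) = 0" by (rule *) simp
  ultimately show "integral\<^sup>L Q (S1 m) = 1" by (simp add: prob_space)
qed

text \<open>Markov's inequality for the gain plus \<open>c\<close>: under \<open>Q\<close> this
  variable is almost surely nonnegative, has mean \<open>c\<close>, and is at least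
  \<open>\<alpha> + c\<close> on the event.\<close>

lemma martingale_measure_gain_bound:
  assumes Q: "Q \<in> martingale_measures m"
    and qs: "quasi_surely m (\<lambda>\<omega>. H * (S1 m \<omega> - S0 m \<omega>) \<ge> - c)" and "0 < c" "0 < \<alpha>"
  shows "measure Q {\<omega> \<in> space (ext_space m). H * (S1 m \<omega> - S0 m \<omega>) \<ge> \<alpha>} \<le> c / \<alpha>"
proof -
  note QD = martingale_measureD[OF Q]
  interpret prob_space Q by (rule QD)
  define A where "A = {\<omega> \<in> space (ext_space m). H * (S1 m \<omega> - S0 m \<omega>) \<ge> \<alpha>}"
  have A: "A \<in> sets Q" unfolding A_def QD(2) S0_def by measurable
  have spc: "space Q = space (ext_space m)" using QD(2) by (rule sets_eq_imp_space_eq)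
  obtain N where N: "N \<in> sets (ext_space m)" "\<And>P. P \<in> priors m \<Longrightarrow> emeasure P N = 0"
    "{\<omega> \<in> space (ext_space m). \<not> - c \<le> H * (S1 m \<omega> - S0 m \<omega>)} \<subseteq> N"
    using qs unfolding quasi_surely_def by blast
  \<comment> \<open>Quasi-sure statements reach \<open>Q\<close> through a prior that dominates
    it.\<close>
  obtain P where P: "P \<in> priors m" "absolutely_continuous P Q"
    using Q by (auto simp: martingale_measures_def)
  have "sets P = sets (ext_space m)" using P(1) by (auto simp: priors_eq)
  then have "N \<in> null_sets P" using N P(1) by (intro null_setsI) auto
  then have "N \<in> null_sets Q" using P(2) by (auto simp: absolutely_continuous_def)
  then have "AE \<omega> in Q. - c \<le> H * (S1 m \<omega> - S0 m \<omega>)"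
    using N(3) by (intro AE_I'[of N]) (auto simp: spc)
  then have ae: "AE \<omega> in Q. (\<alpha> + c) * indicator A \<omega> \<le> H * (S1 m \<omega> - S0 m \<omega>) + c"
    by (rule AE_mp) (use assms(3,4) in \<open>auto simp: A_def indicator_def\<close>)
  have "(\<integral>\<omega>. (\<alpha> + c) * indicator A \<omega> \<partial>Q) \<le> (\<integral>\<omega>. H * (S1 m \<omega> - S0 m \<omega>) + c \<partial>Q)"
    using QD(3) A by (intro integral_mono_AE ae) (auto simp: S0_def emeasure_eq_measure)
  then have "(\<alpha> + c) * measure Q A \<le> c"
    using QD(3,4) A by (simp add: S0_def prob_space)
  moreover have "\<alpha> * measure Q A \<le> (\<alpha> + c) * measure Q A"
    using \<open>0 < c\<close> by (intro mult_right_mono) auto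
  ultimately show ?thesis
    using \<open>0 < \<alpha>\<close> unfolding A_def[symmetric] by (simp add: field_simps)
qed

text \<open>The prior is mixed with a point mass at the extreme price on the other side of 1, in the
  proportion that makes the mean price equal to 1. The lower bound on its weight depends on the
  market only, not on the prior.\<close>

lemma dominating_martingale_measure:
  assumes "P \<in> priors m"
  shows "\<exists>Q\<in>martingale_measures m. \<forall>A\<in>sets (ext_space m).
    min (1 - d_low m) (u_high m - 1) / (u_high m - d_low m) * measure P A \<le> measure Q A"
proof -
  obtain p where p: "p \<in> prior_pmfs" and P: "P = pmf_on (ext_space m) p"
    using assms by (auto simp: priors_eq)
  let ?d = "d_low m" and ?u = "u_high m"
  note bounds = d_low_bounds u_high_bound
  \<comment> \<open>Both weights used below have a numerator of at least this minimum and a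
    denominator of at most \<open>?u - ?d\<close>, so \<open>s\<close> bounds either of them from
    below.\<close>
  define s where "s = min (1 - ?d) (?u - 1) / (?u - ?d)"
  define e where "e = measure_pmf.expectation p (price m)"
  have "\<bar>price m \<omega>\<bar> \<le> ?u" if "\<omega> \<in> set_pmf p" for \<omega>
    using set_prior_pmf_price[OF p that] d_low_bounds by simp
  then have int_p: "integrable (measure_pmf p) (price m)"
    by (intro measure_pmf.integrable_const_bound[of _ ?u] AE_pmfI) simp_all
  have e: "?d \<le> e" "e \<le> ?u"
    using set_prior_pmf_price[OF p] int_p unfolding e_def
    by (auto intro!: measure_pmf.integral_ge_const measure_pmf.integral_le_const simp: AE_measure_pmf_iff)
  \<comment> \<open>For a given \<open>y\<close>, the weight \<open>t\<close> is the solution of the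
    mean equation in the last conjunct.\<close>
  obtain y t where y: "y \<in> {?d, ?u}" and t: "0 \<le> t" "t \<le> 1" "s \<le> t" "t * e + (1 - t) * y = 1"
  proof (cases "1 \<le> e")
    case True
    show ?thesis
    proof (rule that[of ?d "(1 - ?d) / (e - ?d)"])
      show "s \<le> (1 - ?d) / (e - ?d)"
        unfolding s_def using True e bounds by (intro frac_le) auto
      show "(1 - ?d) / (e - ?d) * e + (1 - (1 - ?d) / (e - ?d)) * ?d = 1"
        using True bounds by (simp add: divide_simps) (simp add: algebra_simps)
    qed (use True bounds in \<open>auto simp: divide_simps\<close>)
  next
    case False
    show ?thesis
    proof (rule that[of ?u "(?u - 1) / (?u - e)"])
      show "s \<le> (?u - 1) / (?u - e)"
        unfolding s_def using False e bounds by (intro frac_le) auto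
      show "(?u - 1) / (?u - e) * e + (1 - (?u - 1) / (?u - e)) * ?u = 1"
        using False bounds by (simp add: divide_simps) (simp add: algebra_simps)
    qed (use False bounds in \<open>auto simp: divide_simps\<close>)
  qed
  have ypos: "0 < y" and ybds: "?d \<le> y" "y \<le> ?u" using y bounds by auto
  define q where "q = bind_pmf (bernoulli_pmf t) (\<lambda>b. if b then p else return_pmf (state y))"
  define Q where "Q = pmf_on (ext_space m) q"
  have set_q: "set_pmf q \<subseteq> set_pmf p \<union> {state y}"
    by (auto simp: q_def split: if_splits)
  have q_price: "0 < \<omega>" "\<bar>price m \<omega> - 1\<bar> \<le> ?u + 1" if "\<omega> \<in> set_pmf q" for \<omega>
  proof -
    have "0 < \<omega> \<and> ?d \<le> price m \<omega> \<and> price m \<omega> \<le> ?u"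
      using that set_q set_prior_pmf_price[OF p] ypos ybds state_pos by auto
    then show "0 < \<omega>" "\<bar>price m \<omega> - 1\<bar> \<le> ?u + 1" using bounds by auto
  qed
  have space_q: "set_pmf q \<subseteq> space (ext_space m)" using q_price by auto
  have prob: "prob_space Q" unfolding Q_def by (rule prob_space_pmf_on[OF space_q])
  then interpret prob_space Q .
  have meas: "(\<lambda>\<omega>. S1 m \<omega> - S0 m \<omega>) \<in> borel_measurable (ext_space m)"
    unfolding S0_def by measurable
  have S1: "S1 m = price m" by (auto simp: S1_def)
  have int: "integrable Q (\<lambda>\<omega>. S1 m \<omega> - S0 m \<omega>)"
    unfolding Q_def
    by (rule integrable_pmf_on[OF space_q meas, of "?u + 1"]) (simp add: S0_def S1_def q_price)
  have "measure_pmf.expectation q (price m) = t * e + (1 - t) * price m (state y)"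
    unfolding q_def e_def using t(1,2) int_p
    by (rule expectation_bernoulli_mix) (use price_pos set_prior_pmf_price[OF p] ypos in \<open>auto simp: less_imp_le\<close>)
  then have "integral\<^sup>L Q (S1 m) = 1"
    unfolding Q_def integral_pmf_on[OF space_q measurable_S1] using t(4) ypos by (simp add: S1)
  moreover have "integrable Q (S1 m)"
    using Bochner_Integration.integrable_add[OF int, of "\<lambda>_. 1"] by (simp add: S0_def)
  ultimately have "integral\<^sup>L Q (\<lambda>\<omega>. S1 m \<omega> - S0 m \<omega>) = 0"
    by (simp add: S0_def prob_space)
  then have E: "ext_expectation Q (\<lambda>\<omega>. S1 m \<omega> - S0 m \<omega>) = 0"
    using ext_expectation_integrable[OF int] by (simp add: zero_ereal_def)
  \<comment> \<open>The point mass may sit outside the support of \<open>p\<close>, so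
    \<open>Q\<close> is dominated by an enlarged prior instead.\<close>
  obtain p' where p': "p' \<in> prior_pmfs" "set_pmf p \<union> {state ?u, state ?d} \<subseteq> set_pmf p'"
    using p by (rule prior_pmf_charging_extremes)
  then have "absolutely_continuous (pmf_on (ext_space m) p') Q"
    unfolding Q_def using set_q y by (intro absolutely_continuous_pmf_on) auto
  then have "Q \<in> martingale_measures m"
    using prob E p'(1) by (auto simp: martingale_measures_def priors_eq Q_def)
  moreover have "s * measure P A \<le> measure Q A" if "A \<in> sets (ext_space m)" for A
  proof -
    have "s * measure P A \<le> t * measure P A" using t by (intro mult_right_mono) auto
    also have "\<dots> \<le> measure Q A"
      using that t by (simp add: P Q_def q_def measure_pmf_on prob_bernoulli_mix del: measure_return_pmf)
    finally show ?thesis .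
  qed
  ultimately show ?thesis unfolding s_def by blast
qed

end

section \<open>Asymptotic arbitrage and contiguity\<close>

text \<open>The sum in \<open>gain\<close> is the probability, under the two-point prior with
  parameters \<open>x\<close>, \<open>y\<close>, \<open>p\<close>, that the position
  \<open>H\<close> earns at least \<alpha>. It suffices to have it for infinitely many
  \<open>n\<close>, since an asymptotic arbitrage lives on a subsequence.\<close>

lemma AA1_of_constant_position:
  assumes bm: "\<And>n. binomial_market (M n)" and c: "\<And>n. 0 < c n" "c \<longlonglongrightarrow> 0"
    and loss: "\<And>n s. d_low (M n) \<le> s \<Longrightarrow> s \<le> u_high (M n) \<Longrightarrow> - c n \<le> H * (s - 1)"
    and "0 < \<alpha>"
    and gain: "\<exists>\<^sub>F n in sequentially. \<exists>x y p. (x, y, p) \<in> param_box (M n) \<and>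
      \<alpha> \<le> p * of_bool (\<alpha> \<le> H * (x - 1)) + (1 - p) * of_bool (\<alpha> \<le> H * (y - 1))"
  shows "AA1 M"
proof -
  let ?G = "\<lambda>n x y p. (x, y, p) \<in> param_box (M n) \<and>
      \<alpha> \<le> p * of_bool (\<alpha> \<le> H * (x - 1)) + (1 - p) * of_bool (\<alpha> \<le> H * (y - 1))"
  have "infinite {n. \<exists>x y p. ?G n x y p}"
    using gain by (simp add: frequently_cofinite flip: cofinite_eq_sequentially)
  from infinite_enumerate[OF this] obtain r :: "nat \<Rightarrow> nat" where r: "strict_mono r"
    and r_mem: "\<forall>k. r k \<in> {n. \<exists>x y p. ?G n x y p}" by blast
  have "\<exists>P. P \<in> priors (M (r k)) \<and> \<alpha> \<le> measure P {\<omega> \<in> space (ext_space (M (r k))).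
      H * (S1 (M (r k)) \<omega> - S0 (M (r k)) \<omega>) \<ge> \<alpha>}" for k
  proof -
    interpret binomial_market "M (r k)" by (rule bm)
    have "\<exists>x y p. ?G (r k) x y p" using r_mem by simp
    then obtain x y p where g: "?G (r k) x y p" by (elim exE)
    let ?A = "{\<omega> \<in> space (ext_space (M (r k))). H * (S1 (M (r k)) \<omega> - S0 (M (r k)) \<omega>) \<ge> \<alpha>}"
    let ?q = "two_point_pmf (state x) (state y) p"
    note b = param_boxD[OF conjunct1[OF g]]
    have A: "?A \<in> sets (ext_space (M (r k)))" unfolding S0_def by measurable
    have "emeasure (measure_pmf ?q) ?A =
        ennreal (p * of_bool (\<alpha> \<le> H * (x - 1)) + (1 - p) * of_bool (\<alpha> \<le> H * (y - 1)))"
      using b state_pos by (simp add: emeasure_two_point_pmf indicator_def S1_def S0_def)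
    then have "measure (pmf_on (ext_space (M (r k))) ?q) ?A =
        p * of_bool (\<alpha> \<le> H * (x - 1)) + (1 - p) * of_bool (\<alpha> \<le> H * (y - 1))"
      using b unfolding measure_pmf_on[OF A] by (intro measure_eq_emeasure_eq_ennreal) auto
    then have "\<alpha> \<le> measure (pmf_on (ext_space (M (r k))) ?q) ?A" using g by simp
    moreover have "pmf_on (ext_space (M (r k))) ?q \<in> priors (M (r k))"
      using two_point_prior_pmf[OF conjunct1[OF g]] by (simp add: priors_eq)
    ultimately show ?thesis by blast
  qed
  then obtain P where P: "\<forall>k. P k \<in> priors (M (r k)) \<and>
      \<alpha> \<le> measure (P k) {\<omega> \<in> space (ext_space (M (r k))).
        H * (S1 (M (r k)) \<omega> - S0 (M (r k)) \<omega>) \<ge> \<alpha>}"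
    by metis
  have "quasi_surely (M (r k)) (\<lambda>\<omega>. H * (S1 (M (r k)) \<omega> - S0 (M (r k)) \<omega>) \<ge> - c (r k))" for k
  proof -
    interpret binomial_market "M (r k)" by (rule bm)
    show ?thesis
    proof (rule quasi_surelyI)
      show "{\<omega> \<in> space (ext_space (M (r k))).
          \<not> - c (r k) \<le> H * (S1 (M (r k)) \<omega> - S0 (M (r k)) \<omega>)} \<in> sets (ext_space (M (r k)))"
        unfolding S0_def not_le by measurable
    next
      fix \<omega> assume "d_low (M (r k)) \<le> price (M (r k)) \<omega>" "price (M (r k)) \<omega> \<le> u_high (M (r k))"
      then show "- c (r k) \<le> H * (S1 (M (r k)) \<omega> - S0 (M (r k)) \<omega>)"
        unfolding S0_def S1_def by (rule loss)
    qed
  qed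
  moreover have "(c \<circ> r) \<longlonglongrightarrow> 0" using c(2) r(1) by (rule LIMSEQ_subseq_LIMSEQ)
  ultimately show ?thesis
    unfolding AA1_def using r c(1) P \<open>0 < \<alpha>\<close>
    by (intro exI[of _ r] exI[of _ "\<lambda>_. H"] exI[of _ "c \<circ> r"] exI[of _ \<alpha>] exI[of _ P] conjI) simp_all
qed

text \<open>The gain event of an arbitrage has martingale probability at most
  \<open>c k / \<alpha>\<close>, which vanishes, while its prior probability stays above \<alpha>.
  This contradicts contiguity once the subsequence is completed to full sequences.\<close>

lemma NAA1_of_contiguous:
  assumes bm: "\<And>n. binomial_market (M n)"
    and contig: "\<forall>P. (\<forall>n. P n \<in> priors (M n)) \<longrightarrow>
        (\<exists>Q. (\<forall>n. Q n \<in> martingale_measures (M n)) \<and> contiguous M P Q)"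
  shows "NAA1 M"
  unfolding NAA1_def
proof
  assume "AA1 M"
  then obtain r :: "nat \<Rightarrow> nat" and H c \<alpha> P where r: "strict_mono r" and c: "\<And>k. 0 < c k" "c \<longlonglongrightarrow> 0"
    and qs: "\<And>k. quasi_surely (M (r k)) (\<lambda>\<omega>. H k * (S1 (M (r k)) \<omega> - S0 (M (r k)) \<omega>) \<ge> - c k)"
    and \<alpha>: "0 < \<alpha>" and P: "\<And>k. P k \<in> priors (M (r k))"
    and gain: "\<And>k. \<alpha> \<le> measure (P k) {\<omega> \<in> space (ext_space (M (r k))).
             H k * (S1 (M (r k)) \<omega> - S0 (M (r k)) \<omega>) \<ge> \<alpha>}"
    unfolding AA1_def by blast
  have inv: "inv r (r k) = k" for k
    using r by (simp add: strict_mono_imp_inj_on)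
  \<comment> \<open>Off the subsequence any prior will do, because the event \<open>A n\<close> is
    empty there and contributes 0 on both sides.\<close>
  define P' where "P' n = (if n \<in> range r then P (inv r n) else SOME R. R \<in> priors (M n))" for n
  define A where "A n = (if n \<in> range r then {\<omega> \<in> space (ext_space (M n)).
     H (inv r n) * (S1 (M n) \<omega> - S0 (M n) \<omega>) \<ge> \<alpha>} else {})" for n
  have "P' n \<in> priors (M n)" for n
  proof (cases "n \<in> range r")
    case True
    then show ?thesis using P by (auto simp: P'_def inv)
  next
    case False
    interpret binomial_market "M n" by (rule bm)
    show ?thesis using False priors_nonempty by (simp add: P'_def some_in_eq)
  qed
  then obtain Q where Q: "\<And>n. Q n \<in> martingale_measures (M n)" and cont: "contiguous M P' Q"
    using contig by blast
  have A: "A n \<in> sets (ext_space (M n))" for n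
  proof -
    interpret binomial_market "M n" by (rule bm)
    have "{\<omega> \<in> space (ext_space (M n)). \<alpha> \<le> H (inv r n) * (S1 (M n) \<omega> - 1)} \<in> sets (ext_space (M n))"
      by measurable
    then show ?thesis by (simp add: A_def S0_def)
  qed
  have QA: "measure (Q (r k)) (A (r k)) \<le> c k / \<alpha>" for k
  proof -
    interpret binomial_market "M (r k)" by (rule bm)
    show ?thesis
      using martingale_measure_gain_bound[OF Q qs c(1) \<alpha>] by (simp add: A_def inv)
  qed
  have "(\<lambda>n. measure (Q n) (A n)) \<longlonglongrightarrow> 0"
  proof (rule LIMSEQ_I)
    fix e :: real assume "0 < e"
    then have "\<forall>\<^sub>F k in sequentially. c k < e * \<alpha>"
      using c(2) \<alpha> by (intro order_tendstoD) auto
    then obtain K where K: "\<And>k. K \<le> k \<Longrightarrow> c k < e * \<alpha>"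
      by (auto simp: eventually_sequentially)
    \<comment> \<open>The threshold is \<open>r K\<close>: an index \<open>r k\<close> beyond it has
      \<open>K \<le> k\<close> by monotonicity.\<close>
    have "norm (measure (Q n) (A n) - 0) < e" if "r K \<le> n" for n
    proof (cases "n \<in> range r")
      case True
      then obtain k where k: "n = r k" by auto
      then have "K \<le> k" using that r by (simp add: strict_mono_less_eq)
      then have "c k / \<alpha> < e" using K \<alpha> by (simp add: divide_simps)
      then show ?thesis using QA[of k] by (simp add: k)
    next
      case False
      then show ?thesis using \<open>0 < e\<close> by (simp add: A_def)
    qed
    then show "\<exists>no. \<forall>n\<ge>no. norm (measure (Q n) (A n) - 0) < e" by blast
  qed
  then have "(\<lambda>n. measure (P' n) (A n)) \<longlonglongrightarrow> 0"
    using cont A unfolding contiguous_def by blast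
  then have "((\<lambda>n. measure (P' n) (A n)) \<circ> r) \<longlonglongrightarrow> 0"
    using r by (rule LIMSEQ_subseq_LIMSEQ)
  from order_tendstoD(2)[OF this \<alpha>]
  obtain k where "measure (P' (r k)) (A (r k)) < \<alpha>"
    by (auto simp: eventually_sequentially)
  moreover have "\<alpha> \<le> measure (P' (r k)) (A (r k))"
    using gain by (simp add: P'_def A_def inv)
  ultimately show False by simp
qed

text \<open>A positive limit keeps the weights eventually positive, so one may divide by them and
  squeeze the probabilities under \<open>P\<close>.\<close>

lemma contiguous_of_domination:
  assumes s: "s \<longlonglongrightarrow> l" "0 < (l :: real)"
    and dom: "\<And>n A. A \<in> sets (ext_space (M n)) \<Longrightarrow> s n * measure (P n) A \<le> measure (Q n) A"
  shows "contiguous M P Q"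
  unfolding contiguous_def
proof (intro allI impI)
  fix A assume A: "\<forall>n. A n \<in> sets (ext_space (M n))" and Q: "(\<lambda>n. measure (Q n) (A n)) \<longlonglongrightarrow> 0"
  have "\<forall>\<^sub>F n in sequentially. 0 < s n" using s by (intro order_tendstoD) auto
  then have le: "\<forall>\<^sub>F n in sequentially. measure (P n) (A n) \<le> measure (Q n) (A n) / s n"
  proof eventually_elim
    case (elim n)
    have "s n * measure (P n) (A n) \<le> measure (Q n) (A n)" using A by (intro dom) simp
    with elim show ?case by (simp add: pos_le_divide_eq mult.commute)
  qed
  have lim: "(\<lambda>n. measure (Q n) (A n) / s n) \<longlonglongrightarrow> 0"
    using tendsto_divide[OF Q s(1)] s(2) by simp
  show "(\<lambda>n. measure (P n) (A n)) \<longlonglongrightarrow> 0"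
    by (rule tendsto_sandwich[OF _ le tendsto_const lim]) simp
qed

text \<open>The limit may be infinite; a real number strictly between 1 and the limit still provides
  a real gap.\<close>

lemma ereal_limit_gap_above:
  assumes "(\<lambda>n. ereal (a n)) \<longlonglongrightarrow> l" "1 < l"
  obtains \<delta> where "0 < \<delta>" "\<forall>\<^sub>F n in sequentially. \<delta> \<le> a n - 1"
proof -
  obtain b where b: "1 < ereal b" "ereal b < l" using ereal_dense2[OF assms(2)] by auto
  have "\<forall>\<^sub>F n in sequentially. ereal b < ereal (a n)" using assms(1) b(2) by (rule order_tendstoD)
  then have "\<forall>\<^sub>F n in sequentially. b - 1 \<le> a n - 1" by eventually_elim simp
  with b(1) show ?thesis by (intro that[of "b - 1"]) auto
qed

lemma ereal_limit_gap_below: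
  assumes "(\<lambda>n. ereal (a n)) \<longlonglongrightarrow> l" "l < 1"
  obtains \<delta> where "0 < \<delta>" "\<forall>\<^sub>F n in sequentially. \<delta> \<le> 1 - a n"
proof -
  obtain b where b: "l < ereal b" "ereal b < 1" using ereal_dense2[OF assms(2)] by auto
  have "\<forall>\<^sub>F n in sequentially. ereal (a n) < ereal b" using assms(1) b(1) by (rule order_tendstoD)
  then have "\<forall>\<^sub>F n in sequentially. 1 - b \<le> 1 - a n" by eventually_elim simp
  with b(2) show ?thesis by (intro that[of "1 - b"]) auto
qed

theorem theorem5p7:
  fixes M :: "nat \<Rightarrow> market" and d D u U :: ereal
  assumes market: "\<And>n. valid_market (M n)"
    and A1: "\<And>n. 0 < p_low (M n) \<and> p_low (M n) \<le> p_high (M n) \<and> p_high (M n) < 1"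
      "\<And>n. d_low (M n) \<le> d_high (M n) \<and> u_low (M n) \<le> u_high (M n)"
      "\<And>n. 0 < d_low (M n) \<and> d_low (M n) < 1 \<and> 1 < u_high (M n)"
    and A2: "\<And>n. d_low (M n) < min (u_low (M n)) (d_high (M n))"
      "\<And>n. max (u_low (M n)) (d_high (M n)) < u_high (M n)"
    and A3: "d \<in> {0..1}" "D \<in> {0..\<infinity>}" "u \<in> {0..\<infinity>}" "U \<in> {1..\<infinity>}"
      "(\<lambda>n. ereal (d_low (M n))) \<longlonglongrightarrow> d" "(\<lambda>n. ereal (d_high (M n))) \<longlonglongrightarrow> D"
      "(\<lambda>n. ereal (u_low (M n))) \<longlonglongrightarrow> u" "(\<lambda>n. ereal (u_high (M n))) \<longlonglongrightarrow> U"
    and A4: "d < U"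
      "{d..D} \<noteq> {1} \<or> limsup (\<lambda>n. ereal (p_high (M n))) > 0"
      "{u..U} \<noteq> {1} \<or> liminf (\<lambda>n. ereal (p_low (M n))) < 1"
    and U_finite: "U < \<infinity>"
  shows "(NAA1 M \<longleftrightarrow> d < 1 \<and> 1 < U) \<and>
    (d < 1 \<and> 1 < U \<longleftrightarrow>
      (\<forall>P. (\<forall>n. P n \<in> priors (M n)) \<longrightarrow>
        (\<exists>Q. (\<forall>n. Q n \<in> martingale_measures (M n)) \<and> contiguous M P Q)))"
proof -
  have bm: "binomial_market (M n)" for n
    using market[of n] A1(1-3)[of n] A2(1,2)[of n] by unfold_locales auto
  \<comment> \<open>Holding one share loses at most \<open>1 - d_low (M n)\<close>, which tends to
    0.\<close>
  have "AA1 M" if "d = 1"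
  proof -
    have c: "(\<lambda>n. 1 - d_low (M n)) \<longlonglongrightarrow> 0"
    proof -
      have "(\<lambda>n. d_low (M n)) \<longlonglongrightarrow> 1"
        using A3(5) unfolding \<open>d = 1\<close> one_ereal_def by (simp only: lim_ereal)
      from tendsto_diff[OF tendsto_const[of 1] this] show ?thesis by simp
    qed
    have "1 < U" using A4(1) \<open>d = 1\<close> by simp
    with A3(8) obtain \<delta> where \<delta>: "0 < \<delta>" "\<forall>\<^sub>F n in sequentially. \<delta> \<le> u_high (M n) - 1"
      by (rule ereal_limit_gap_above)
    show ?thesis
    proof (cases "D = 1")
      case True
      \<comment> \<open>Down prices tend to 1 here, so the gain has to come from the up price. (A4)
        keeps the largest up probability above some \<open>e\<close> infinitely often, and both the
        size and the probability of the gain are bounded below by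
        \<open>min \<delta> e\<close>.\<close>
      then have "0 < limsup (\<lambda>n. ereal (p_high (M n)))" using A4(2) \<open>d = 1\<close> by simp
      then obtain e where e: "0 < ereal e" "ereal e < limsup (\<lambda>n. ereal (p_high (M n)))"
        by (meson ereal_dense2)
      then have "\<not> (\<forall>\<^sub>F n in sequentially. ereal (p_high (M n)) \<le> ereal e)"
        using Limsup_bounded[where F = sequentially and X = "\<lambda>n. ereal (p_high (M n))" and C = "ereal e"] by (auto simp: not_le)
      then have fr: "\<exists>\<^sub>F n in sequentially. e < p_high (M n)"
        by (simp add: frequently_def not_less)
      show ?thesis
      proof (rule AA1_of_constant_position[OF bm _ c, where H = 1 and \<alpha> = "min \<delta> e"])
        show "\<exists>\<^sub>F n in sequentially. \<exists>x y p. (x, y, p) \<in> param_box (M n) \<and>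
            min \<delta> e \<le> p * of_bool (min \<delta> e \<le> 1 * (x - 1)) + (1 - p) * of_bool (min \<delta> e \<le> 1 * (y - 1))"
        proof (rule frequently_rev_mp[OF fr], rule eventually_mono[OF \<delta>(2)], rule impI)
          fix n assume "\<delta> \<le> u_high (M n) - 1" "e < p_high (M n)"
          then show "\<exists>x y p. (x, y, p) \<in> param_box (M n) \<and>
            min \<delta> e \<le> p * of_bool (min \<delta> e \<le> 1 * (x - 1)) + (1 - p) * of_bool (min \<delta> e \<le> 1 * (y - 1))"
            using A1[of n]
            by (intro exI[of _ "u_high (M n)"] exI[of _ "d_low (M n)"] exI[of _ "p_high (M n)"])
              (auto simp: param_box_def min_def)
        qed
      qed (use A1(3) \<delta>(1) e(1) in auto)
    next
      case False
      have "d \<le> D"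
        using A3(5,6) A1(2) by (intro LIMSEQ_le[OF A3(5,6)]) auto
      with False \<open>d = 1\<close> have "1 < D" by auto
      with A3(6) obtain \<epsilon> where \<epsilon>: "0 < \<epsilon>" "\<forall>\<^sub>F n in sequentially. \<epsilon> \<le> d_high (M n) - 1"
        by (rule ereal_limit_gap_above)
      \<comment> \<open>With the highest up and down prices both outcomes gain, so the gain is
        certain. The cap 1 is there because \<alpha> also bounds a probability.\<close>
      let ?a = "min 1 (min \<delta> \<epsilon>)"
      show ?thesis
      proof (rule AA1_of_constant_position[OF bm _ c, where H = 1 and \<alpha> = ?a])
        have "\<forall>\<^sub>F n in sequentially. \<exists>x y p. (x, y, p) \<in> param_box (M n) \<and>
            ?a \<le> p * of_bool (?a \<le> 1 * (x - 1)) + (1 - p) * of_bool (?a \<le> 1 * (y - 1))"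
          using \<delta>(2) \<epsilon>(2)
        proof eventually_elim
          case (elim n)
          then show ?case
            using A1[of n]
            by (intro exI[of _ "u_high (M n)"] exI[of _ "d_high (M n)"] exI[of _ "p_high (M n)"])
              (auto simp: param_box_def min_le_iff_disj)
        qed
        then show "\<exists>\<^sub>F n in sequentially. \<exists>x y p. (x, y, p) \<in> param_box (M n) \<and>
            ?a \<le> p * of_bool (?a \<le> 1 * (x - 1)) + (1 - p) * of_bool (?a \<le> 1 * (y - 1))"
          by (rule eventually_frequently[OF sequentially_bot])
      qed (use A1(3) \<delta>(1) \<epsilon>(1) in auto)
    qed
  qed
  \<comment> \<open>The mirror image: selling one share loses at most
    \<open>u_high (M n) - 1\<close>, which tends to 0.\<close>
  moreover have "AA1 M" if "U = 1"
  proof -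
    have c: "(\<lambda>n. u_high (M n) - 1) \<longlonglongrightarrow> 0"
    proof -
      have "(\<lambda>n. u_high (M n)) \<longlonglongrightarrow> 1"
        using A3(8) unfolding \<open>U = 1\<close> one_ereal_def by (simp only: lim_ereal)
      from tendsto_diff[OF this tendsto_const[of 1]] show ?thesis by simp
    qed
    have "d < 1" using A4(1) \<open>U = 1\<close> by simp
    with A3(5) obtain \<delta> where \<delta>: "0 < \<delta>" "\<forall>\<^sub>F n in sequentially. \<delta> \<le> 1 - d_low (M n)"
      by (rule ereal_limit_gap_below)
    show ?thesis
    proof (cases "u = 1")
      case True
      \<comment> \<open>Now only the down price earns a gain. Infinitely often the smallest up
        probability is below some \<open>e < 1\<close>, leaving mass above \<open>1 - e\<close> on
        the lowest price.\<close>
      then have "liminf (\<lambda>n. ereal (p_low (M n))) < 1" using A4(3) \<open>U = 1\<close> by simp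
      then obtain e where e: "liminf (\<lambda>n. ereal (p_low (M n))) < ereal e" "ereal e < 1"
        by (meson ereal_dense2)
      then have "\<not> (\<forall>\<^sub>F n in sequentially. ereal e \<le> ereal (p_low (M n)))"
        using Liminf_bounded[where F = sequentially and X = "\<lambda>n. ereal (p_low (M n))" and C = "ereal e"] by (auto simp: not_le)
      then have fr: "\<exists>\<^sub>F n in sequentially. p_low (M n) < e"
        by (simp add: frequently_def not_less)
      let ?a = "min \<delta> (1 - e)"
      show ?thesis
      proof (rule AA1_of_constant_position[OF bm _ c, where H = "-1" and \<alpha> = ?a])
        show "\<exists>\<^sub>F n in sequentially. \<exists>x y p. (x, y, p) \<in> param_box (M n) \<and>
            ?a \<le> p * of_bool (?a \<le> -1 * (x - 1)) + (1 - p) * of_bool (?a \<le> -1 * (y - 1))"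
        proof (rule frequently_rev_mp[OF fr], rule eventually_mono[OF \<delta>(2)], rule impI)
          fix n assume "\<delta> \<le> 1 - d_low (M n)" "p_low (M n) < e"
          then show "\<exists>x y p. (x, y, p) \<in> param_box (M n) \<and>
            ?a \<le> p * of_bool (?a \<le> -1 * (x - 1)) + (1 - p) * of_bool (?a \<le> -1 * (y - 1))"
            using A1[of n]
            by (intro exI[of _ "u_high (M n)"] exI[of _ "d_low (M n)"] exI[of _ "p_low (M n)"])
              (auto simp: param_box_def min_le_iff_disj)
        qed
      qed (use A1(3) \<delta>(1) e(2) in auto)
    next
      case False
      have "u \<le> U"
        using A1(2) by (intro LIMSEQ_le[OF A3(7,8)]) auto
      with False \<open>U = 1\<close> have "u < 1" by auto
      with A3(7) obtain \<epsilon> where \<epsilon>: "0 < \<epsilon>" "\<forall>\<^sub>F n in sequentially. \<epsilon> \<le> 1 - u_low (M n)"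
        by (rule ereal_limit_gap_below)
      let ?a = "min 1 (min \<delta> \<epsilon>)"
      show ?thesis
      proof (rule AA1_of_constant_position[OF bm _ c, where H = "-1" and \<alpha> = ?a])
        have "\<forall>\<^sub>F n in sequentially. \<exists>x y p. (x, y, p) \<in> param_box (M n) \<and>
            ?a \<le> p * of_bool (?a \<le> -1 * (x - 1)) + (1 - p) * of_bool (?a \<le> -1 * (y - 1))"
          using \<delta>(2) \<epsilon>(2)
        proof eventually_elim
          case (elim n)
          then show ?case
            using A1[of n]
            by (intro exI[of _ "u_low (M n)"] exI[of _ "d_low (M n)"] exI[of _ "p_low (M n)"])
              (auto simp: param_box_def min_le_iff_disj)
        qed
        then show "\<exists>\<^sub>F n in sequentially. \<exists>x y p. (x, y, p) \<in> param_box (M n) \<and>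
            ?a \<le> p * of_bool (?a \<le> -1 * (x - 1)) + (1 - p) * of_bool (?a \<le> -1 * (y - 1))"
          by (rule eventually_frequently[OF sequentially_bot])
      qed (use A1(3) \<delta>(1) \<epsilon>(1) in auto)
    qed
  qed
  \<comment> \<open>By these bounds, a failure of (ii) means \<open>d = 1\<close> or
    \<open>U = 1\<close>, the two cases just treated.\<close>
  moreover have "d \<le> 1" "1 \<le> U" using A3(1,4) by auto
  ultimately have i_ii: "d < 1 \<and> 1 < U" if "NAA1 M"
    using that unfolding NAA1_def by (auto simp: order_le_less)
  have ii_iii: "\<exists>Q. (\<forall>n. Q n \<in> martingale_measures (M n)) \<and> contiguous M P Q"
    if ii: "d < 1 \<and> 1 < U" and P: "\<forall>n. P n \<in> priors (M n)" for P
  proof -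
    let ?s = "\<lambda>n. min (1 - d_low (M n)) (u_high (M n) - 1) / (u_high (M n) - d_low (M n))"
    have "\<exists>Q\<in>martingale_measures (M n). \<forall>A\<in>sets (ext_space (M n)).
        ?s n * measure (P n) A \<le> measure Q A" for n
      using bm P[rule_format] by (rule binomial_market.dominating_martingale_measure)
    then obtain Q where Q: "\<And>n. Q n \<in> martingale_measures (M n)"
      "\<And>n A. A \<in> sets (ext_space (M n)) \<Longrightarrow> ?s n * measure (P n) A \<le> measure (Q n) A"
      by metis
    obtain d' where d': "d = ereal d'" using A3(1) by (cases d) auto
    \<comment> \<open>Finiteness of \<open>U\<close> keeps the limit of the weights
      \<open>?s\<close> positive; with \<open>U\<close> infinite the denominators would diverge
      while the numerators stay below 1, and the weights would vanish.\<close>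
    obtain U' where U': "U = ereal U'" using A3(4) U_finite by (cases U) auto
    have lims: "(\<lambda>n. d_low (M n)) \<longlonglongrightarrow> d'" "(\<lambda>n. u_high (M n)) \<longlonglongrightarrow> U'"
      using A3(5,8) by (simp_all add: d' U')
    have lt: "d' < 1" "1 < U'" using ii by (simp_all add: d' U')
    have "?s \<longlonglongrightarrow> min (1 - d') (U' - 1) / (U' - d')"
      using lt by (intro tendsto_intros tendsto_min lims) auto
    moreover have "0 < min (1 - d') (U' - 1) / (U' - d')" using lt by simp
    ultimately have "contiguous M P Q" using Q(2) by (rule contiguous_of_domination)
    with Q(1) show ?thesis by blast
  qed
  have cycle: "(A \<longleftrightarrow> B) \<and> (B \<longleftrightarrow> C)" if "A \<Longrightarrow> B" "B \<Longrightarrow> C" "C \<Longrightarrow> A" for A B C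
    using that by blast
  show ?thesis
    by (rule cycle[OF i_ii _ NAA1_of_contiguous[OF bm]]) (use ii_iii in simp_all)
qed

end
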